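(* Let $\mathbb P$ be a probability measure on $\Omega_+$ under which the sequence $(\omega(x))_{x\ge0}$ is stationary and ergodic (with respect to the shift). Then either every $x\ge0$ is $\mathbb P$-a.s. $\omega$-recurrent, or every $x\ge0$ is $\mathbb P$-a.s. $\omega$-transient.
   Context: Cookie environments: $\Omega_+=([1/2,1]^{\mathbb N})^{\mathbb Z}$ with its product $\sigma$-field, $\omega(x)=(\omega(x,i))_{i\ge1}$. $P_{x,\omega}$ is the law of the nearest-neighbor process $(X_n)_{n\ge0}$ with $X_0=x$ which, on its $i$-th visit to site $z$, jumps to $z+1$ with probability $\omega(z,i)$ and to $z-1$ otherwise. $R_k=\{X_n=k\text{ i.o.}\}$; a site $y$ is $\omega$-recurrent if $P_{x,\omega}[R_y]=1$ for all $x\in\mathbb Z$, and $\omega$-transient if $P_{x,\omega}[R_y]=0$ for all $x\in\mathbb Z$ (for fixed $\omega$ one of these always holds). *)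

theory Defs
  imports "HOL-Probability.Probability"
begin

text \<open>Cookie environments. An environment is \<open>\<omega> :: int \<Rightarrow> nat \<Rightarrow> real\<close>, where
  \<open>\<omega> z k\<close> is the cookie strength used on the (k+1)-th visit to site z
  (0-based visit index), with values in [1/2,1].\<close>

type_synonym env = "int \<Rightarrow> nat \<Rightarrow> real"

definition cookie_coord :: "real measure" where
  "cookie_coord = restrict_space borel {1/2..1}"

definition Omega_plus :: "env measure" where
  "Omega_plus = PiM UNIV (\<lambda>_::int. PiM UNIV (\<lambda>_::nat. cookie_coord))"

definition Omega_half :: "(nat \<Rightarrow> nat \<Rightarrow> real) measure" where
  "Omega_half = PiM UNIV (\<lambda>_::nat. PiM UNIV (\<lambda>_::nat. cookie_coord))"

definition nonneg_part :: "env \<Rightarrow> (nat \<Rightarrow> nat \<Rightarrow> real)" where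
  "nonneg_part \<omega> = (\<lambda>n. \<omega> (int n))"

definition seq_shift :: "(nat \<Rightarrow> nat \<Rightarrow> real) \<Rightarrow> (nat \<Rightarrow> nat \<Rightarrow> real)" where
  "seq_shift s = (\<lambda>n. s (Suc n))"

definition stationary_ergodic_nonneg :: "env measure \<Rightarrow> bool" where
  "stationary_ergodic_nonneg P \<longleftrightarrow>
     (let Q = distr P Omega_half nonneg_part in
        distr Q Omega_half seq_shift = Q \<and>
        (\<forall>A \<in> sets Omega_half. seq_shift -` A \<inter> space Omega_half = A \<longrightarrow>
             emeasure Q A = 0 \<or> emeasure Q A = 1))"

text \<open>Construction of the excited random walk from i.i.d. uniform [0,1] variables \<open>u n\<close>:
  at time n the walk at p, on its (c p + 1)-th visit to p, jumps right iff
  \<open>u n < \<omega> p (c p)\<close>, i.e. with probability \<open>\<omega> p (c p)\<close>. The state records the position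
  and the number of visits so far (strictly before the current time) to each site.\<close>
fun ewalk_state :: "env \<Rightarrow> int \<Rightarrow> (nat \<Rightarrow> real) \<Rightarrow> nat \<Rightarrow> int \<times> (int \<Rightarrow> nat)" where
  "ewalk_state \<omega> x u 0 = (x, (\<lambda>_. 0))"
| "ewalk_state \<omega> x u (Suc n) =
     (let (p, c) = ewalk_state \<omega> x u n
      in (if u n < \<omega> p (c p) then p + 1 else p - 1, c(p := Suc (c p))))"

definition ewalk :: "env \<Rightarrow> int \<Rightarrow> (nat \<Rightarrow> real) \<Rightarrow> nat \<Rightarrow> int" where
  "ewalk \<omega> x u n = fst (ewalk_state \<omega> x u n)"

definition driving_space :: "(nat \<Rightarrow> real) measure" where
  "driving_space = PiM UNIV (\<lambda>_::nat. uniform_measure lborel {0..1})"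

definition prob_R :: "env \<Rightarrow> int \<Rightarrow> int \<Rightarrow> real" where
  "prob_R \<omega> x y = measure driving_space
      {u \<in> space driving_space. \<forall>n. \<exists>m\<ge>n. ewalk \<omega> x u m = y}"

definition env_recurrent :: "env \<Rightarrow> int \<Rightarrow> bool" where
  "env_recurrent \<omega> y \<longleftrightarrow> (\<forall>x. prob_R \<omega> x y = 1)"

definition env_transient :: "env \<Rightarrow> int \<Rightarrow> bool" where
  "env_transient \<omega> y \<longleftrightarrow> (\<forall>x. prob_R \<omega> x y = 0)"

end

theory Submission
  imports Defs
begin

text \<open>
  Sample the walk from independent arrows, one for each pair (site, index of the visit). Almost
  surely the walk has limit superior \<open>\<infinity>\<close>, because it stays above a simple random walk. Hence
  excursions to the left of a site \<open>N\<close> are finite, and the trace of the walk on \<open>{N..}\<close> depends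
  neither on the arrows to the left of \<open>N\<close> nor on a starting point in \<open>{..N}\<close>. Whether \<open>y\<close> is
  visited infinitely often is therefore decided by whether \<open>N\<close> is, together with whether each site
  in \<open>{y<..N}\<close> has infinitely many left arrows. This is a tail event, so for a fixed environment
  recurrence of \<open>y\<close> has probability 0 or 1, does not depend on the starting point or on the
  cookies to the left of \<open>y\<close>, and is inherited by the sites to the right of \<open>y\<close>. So the events
  that \<open>n\<close> is recurrent increase with \<open>n\<close>, and they all have the same probability by
  stationarity; their union is shift invariant and has probability 0 or 1 by ergodicity.
\<close>

subsection \<open>Walks driven by a rule\<close>

text \<open>The rule \<open>b\<close> may look at the time, the site and the number of earlier
  visits. This covers both the walk driven by one uniform variable per time step and the walk driven
  by arrows.\<close>

fun gst :: "(nat \<Rightarrow> int \<Rightarrow> nat \<Rightarrow> bool) \<Rightarrow> int \<Rightarrow> nat \<Rightarrow> int \<times> (int \<Rightarrow> nat)" where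
  "gst b x 0 = (x, \<lambda>_. 0)"
| "gst b x (Suc n) =
     (let (p, c) = gst b x n in (if b n p (c p) then p + 1 else p - 1, c(p := Suc (c p))))"

definition pos :: "(nat \<Rightarrow> int \<Rightarrow> nat \<Rightarrow> bool) \<Rightarrow> int \<Rightarrow> nat \<Rightarrow> int" where
  "pos b x n = fst (gst b x n)"

definition cnt :: "(nat \<Rightarrow> int \<Rightarrow> nat \<Rightarrow> bool) \<Rightarrow> int \<Rightarrow> nat \<Rightarrow> int \<Rightarrow> nat" where
  "cnt b x n = snd (gst b x n)"

definition visits_io :: "(nat \<Rightarrow> int \<Rightarrow> nat \<Rightarrow> bool) \<Rightarrow> int \<Rightarrow> int \<Rightarrow> bool" where
  "visits_io b x y \<longleftrightarrow> (\<forall>n. \<exists>m\<ge>n. pos b x m = y)"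

definition unbounded_above :: "(nat \<Rightarrow> int \<Rightarrow> nat \<Rightarrow> bool) \<Rightarrow> int \<Rightarrow> bool" where
  "unbounded_above b x \<longleftrightarrow> (\<forall>K n. \<exists>m\<ge>n. K \<le> pos b x m)"

lemma pos_0 [simp]: "pos b x 0 = x"
  by (simp add: pos_def)

lemma cnt_0 [simp]: "cnt b x 0 = (\<lambda>_. 0)"
  by (simp add: cnt_def)

lemma pos_Suc:
  "pos b x (Suc n) =
    (if b n (pos b x n) (cnt b x n (pos b x n)) then pos b x n + 1 else pos b x n - 1)"
  by (simp add: pos_def cnt_def case_prod_unfold Let_def)

lemma cnt_Suc:
  "cnt b x (Suc n) = (cnt b x n)(pos b x n := Suc (cnt b x n (pos b x n)))"
  by (simp add: pos_def cnt_def case_prod_unfold Let_def)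

lemma cnt_mono: "m \<le> n \<Longrightarrow> cnt b x m z \<le> cnt b x n z"
  by (induction n rule: dec_induct) (auto simp: cnt_Suc)

text \<open>Being at a site raises its counter, so no pair of a site and a visit index occurs at two
  different times.\<close>

lemma cnt_less: "m < n \<Longrightarrow> cnt b x m (pos b x m) < cnt b x n (pos b x m)"
  using cnt_mono[of "Suc m" n b x "pos b x m"] by (simp add: cnt_Suc)

lemma cnt_attained:
  assumes "i < cnt b x n z"
  shows "\<exists>m<n. pos b x m = z \<and> cnt b x m z = i"
  using assms
proof (induction n)
  case (Suc n)
  show ?case
  proof (cases "i < cnt b x n z")
    case True
    then show ?thesis using Suc.IH less_Suc_eq by blast
  next
    case False
    then have "pos b x n = z \<and> cnt b x n z = i"
      using Suc.prems by (auto simp: cnt_Suc split: if_splits)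
    then show ?thesis by blast
  qed
qed simp

text \<open>Counters, unlike times, can be compared between two walks whose excursions differ; the
  trace argument relies on this form.\<close>

lemma visits_io_iff_cnt: "visits_io b x y \<longleftrightarrow> (\<forall>k. \<exists>n. k \<le> cnt b x n y)"
proof
  assume io: "visits_io b x y"
  show "\<forall>k. \<exists>n. k \<le> cnt b x n y"
  proof
    fix k show "\<exists>n. k \<le> cnt b x n y"
    proof (induction k)
      case (Suc k)
      then obtain n where n: "k \<le> cnt b x n y" by blast
      obtain m where "m \<ge> n" "pos b x m = y" using io unfolding visits_io_def by blast
      then have "Suc k \<le> cnt b x (Suc m) y" using n cnt_mono[of n m b x y] by (simp add: cnt_Suc)
      then show ?case by blast
    qed simp
  qed
next
  assume unb: "\<forall>k. \<exists>n. k \<le> cnt b x n y"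
  show "visits_io b x y" unfolding visits_io_def
  proof
    fix n
    obtain n' where "Suc (cnt b x n y) \<le> cnt b x n' y" using unb by blast
    then obtain m where m: "pos b x m = y" "cnt b x m y = cnt b x n y"
      using cnt_attained[of "cnt b x n y"] by (metis Suc_le_eq)
    then have "m \<ge> n" using cnt_less[of m n b x] by (metis less_irrefl not_le)
    then show "\<exists>m\<ge>n. pos b x m = y" using m by blast
  qed
qed

section \<open>Level crossings of a nearest-neighbor path\<close>

lemma up_crossing:
  assumes "pos b x m \<le> z" "m \<le> n" "z \<le> pos b x n"
  shows "\<exists>t\<ge>m. t \<le> n \<and> pos b x t = z"
  using assms(2,3)
proof (induction n rule: dec_induct)
  case base
  then show ?case using assms(1) by (intro exI[of _ m]) auto
next
  case (step n)
  show ?case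
  proof (cases "z \<le> pos b x n")
    case True
    then show ?thesis using step.IH le_SucI by blast
  next
    case False
    then have "pos b x (Suc n) = z" using step.prems by (auto simp: pos_Suc split: if_splits)
    then show ?thesis using step.hyps by (intro exI[of _ "Suc n"]) auto
  qed
qed

lemma down_crossing:
  assumes "z \<le> pos b x m" "m \<le> n" "pos b x n < z"
  shows "\<exists>t\<ge>m. pos b x t = z \<and> pos b x (Suc t) = z - 1"
  using assms(2,3)
proof (induction n rule: dec_induct)
  case (step n)
  show ?case
  proof (cases "pos b x n < z")
    case True
    then show ?thesis using step.IH by blast
  next
    case False
    then have "pos b x n = z \<and> pos b x (Suc n) = z - 1"
      using step.prems by (auto simp: pos_Suc split: if_splits)
    then show ?thesis using step.hyps by blast
  qed
qed (use assms(1) in simp)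

text \<open>After each visit to \<open>y\<close> the path climbs to \<open>z\<close> or higher, and
  unit steps cannot jump over \<open>z\<close>.\<close>

lemma visits_io_up:
  assumes "visits_io b x y" "unbounded_above b x" "y \<le> z"
  shows "visits_io b x z"
  unfolding visits_io_def
proof
  fix n
  obtain m where m: "m \<ge> n" "pos b x m = y" using assms(1) unfolding visits_io_def by blast
  obtain l where l: "l \<ge> m" "z \<le> pos b x l" using assms(2) unfolding unbounded_above_def by blast
  show "\<exists>m\<ge>n. pos b x m = z"
    using up_crossing[of b x m z l] m l assms(3) by (metis le_trans)
qed

subsection \<open>Walks following arrows\<close>

text \<open>An arrow configuration fixes in advance the direction \<open>a z i\<close> of the jump after the
  \<open>i\<close>-th visit to \<open>z\<close> (\<open>True\<close> is to the right).\<close>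

abbreviation arrows :: "(int \<Rightarrow> nat \<Rightarrow> bool) \<Rightarrow> nat \<Rightarrow> int \<Rightarrow> nat \<Rightarrow> bool" where
  "arrows a \<equiv> \<lambda>_. a"

definition inf_left :: "(int \<Rightarrow> nat \<Rightarrow> bool) \<Rightarrow> int \<Rightarrow> bool" where
  "inf_left a z \<longleftrightarrow> (\<forall>n. \<exists>i\<ge>n. \<not> a z i)"

text \<open>Infinitely many visits to \<open>z\<close> use every arrow there, including the
  infinitely many that point left.\<close>

lemma visits_io_down:
  assumes io: "visits_io (arrows a) x z" and left: "inf_left a z"
  shows "visits_io (arrows a) x (z - 1)"
  unfolding visits_io_def
proof
  fix n
  let ?b = "arrows a"
  obtain i where i: "i \<ge> cnt ?b x n z" "\<not> a z i" using left unfolding inf_left_def by blast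
  obtain n' where "Suc i \<le> cnt ?b x n' z" using io unfolding visits_io_iff_cnt by blast
  then obtain m where m: "pos ?b x m = z" "cnt ?b x m z = i"
    using cnt_attained by (metis Suc_le_eq)
  then have "m \<ge> n" using cnt_less[of m n ?b x] i(1) by (metis leD not_le)
  moreover have "pos ?b x (Suc m) = z - 1" using m i(2) by (simp add: pos_Suc)
  ultimately show "\<exists>m\<ge>n. pos ?b x m = z - 1" by (metis le_SucI)
qed

text \<open>Between a late time at or above \<open>z\<close> and a later visit to \<open>y\<close>
  the walk leaves \<open>z\<close> to the left, using an arrow of arbitrarily large index.\<close>

lemma inf_left_if_visits_io:
  assumes io: "visits_io (arrows a) x y" and unb: "unbounded_above (arrows a) x" and yz: "y < z"
  shows "inf_left a z"
  unfolding inf_left_def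
proof
  fix i
  let ?b = "arrows a"
  have "visits_io ?b x z" using visits_io_up[OF io unb] yz by simp
  then obtain n where n: "i \<le> cnt ?b x n z" unfolding visits_io_iff_cnt by blast
  obtain m where m: "m \<ge> n" "z \<le> pos ?b x m" using unb unfolding unbounded_above_def by blast
  obtain l where l: "l \<ge> m" "pos ?b x l = y" using io unfolding visits_io_def by blast
  obtain t where t: "t \<ge> m" "pos ?b x t = z" "pos ?b x (Suc t) = z - 1"
    using down_crossing[of z ?b x m l] m l yz by auto
  have "\<not> a z (cnt ?b x t z)" using t by (auto simp: pos_Suc split: if_splits)
  moreover have "i \<le> cnt ?b x t z" using n cnt_mono[of n t ?b x z] t m by simp
  ultimately show "\<exists>j\<ge>i. \<not> a z j" by blast
qed

lemma visits_io_downto: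
  assumes "visits_io (arrows a) x N" "y \<le> N" "\<And>z. y < z \<Longrightarrow> z \<le> N \<Longrightarrow> inf_left a z"
  shows "visits_io (arrows a) x y"
  using assms(2,3)
proof (induction y rule: int_le_induct)
  case base
  then show ?case using assms(1) by simp
next
  case (step z)
  then show ?case using visits_io_down[of a x z] by simp
qed

text \<open>Seen from the half line to the right of \<open>N\<close>, an excursion to the left of \<open>N\<close> is invisible,
  so the trace of a walk there depends on the arrows to the right of \<open>N\<close> only.\<close>

lemma return_right:
  assumes "\<forall>n. \<exists>m\<ge>n. N \<le> pos b x m" "pos b x n \<le> N"
  shows "\<exists>m\<ge>n. pos b x m = N \<and> (\<forall>z\<ge>N. cnt b x m z = cnt b x n z)"
proof -
  define P where "P m \<longleftrightarrow> m \<ge> n \<and> N \<le> pos b x m" for m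
  define m where "m = (LEAST m. P m)"
  have "\<exists>m. P m" using assms(1) unfolding P_def by blast
  then have Pm: "P m" unfolding m_def by (rule LeastI_ex)
  have least: "pos b x k < N" if "n \<le> k" "k < m" for k
    using not_less_Least[of k P] that unfolding m_def P_def by auto
  have "cnt b x k z = cnt b x n z" if "z \<ge> N" "n \<le> k" "k \<le> m" for k z
    using that(2,3)
  proof (induction k rule: dec_induct)
    case (step k)
    then show ?case using least[of k] that(1) by (simp add: cnt_Suc)
  qed simp
  then have "\<forall>z\<ge>N. cnt b x m z = cnt b x n z" using Pm unfolding P_def by blast
  moreover obtain t where "t \<ge> n" "t \<le> m" "pos b x t = N"
    using up_crossing[OF assms(2), of m] Pm unfolding P_def by blast
  then have "pos b x m = N" using least[of t] by (cases "t = m") auto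
  ultimately show ?thesis using Pm unfolding P_def by blast
qed

text \<open>Induction on \<open>n\<close>. While the first walk is to the left of \<open>N\<close>,
  the second one waits at \<open>N\<close>, hence the \<open>max\<close>. Only excursions of the
  second walk have to be skipped, so the return hypothesis concerns that walk alone.\<close>

lemma trace_right:
  assumes agree: "\<And>z i. z \<ge> N \<Longrightarrow> a z i = a' z i" and x: "x \<le> N" "x' \<le> N"
    and ret: "\<forall>n. \<exists>m\<ge>n. N \<le> pos (arrows a') x' m"
  shows "\<exists>n'. pos (arrows a') x' n' = max N (pos (arrows a) x n) \<and>
    (\<forall>z\<ge>N. cnt (arrows a') x' n' z = cnt (arrows a) x n z)"
proof (induction n)
  case 0
  show ?case using return_right[OF ret, of 0] x by (auto simp: max_def)
next
  case (Suc n)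
  let ?b = "arrows a" and ?b' = "arrows a'"
  obtain n' where n': "pos ?b' x' n' = max N (pos ?b x n)"
    "\<And>z. z \<ge> N \<Longrightarrow> cnt ?b' x' n' z = cnt ?b x n z" using Suc.IH by blast
  show ?case
  proof (cases "pos ?b x n < N")
    case True
    then have "max N (pos ?b x (Suc n)) = N" by (auto simp: pos_Suc)
    moreover have "cnt ?b x (Suc n) z = cnt ?b x n z" if "z \<ge> N" for z
      using that True by (simp add: cnt_Suc)
    ultimately show ?thesis using n' True by (intro exI[of _ n']) auto
  next
    case False
    then have p: "pos ?b' x' n' = pos ?b x n" using n'(1) by simp
    then have pS: "pos ?b' x' (Suc n') = pos ?b x (Suc n)"
      using agree False n'(2) by (simp add: pos_Suc)
    have cS: "cnt ?b' x' (Suc n') z = cnt ?b x (Suc n) z" if "z \<ge> N" for z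
      using that n'(2) p False by (simp add: cnt_Suc)
    show ?thesis
    proof (cases "N \<le> pos ?b x (Suc n)")
      case True
      then show ?thesis using pS cS by (intro exI[of _ "Suc n'"]) auto
    next
      case False
      then show ?thesis using return_right[OF ret, of "Suc n'"] pS cS by (auto simp: max_def)
    qed
  qed
qed

lemma visits_io_trace:
  assumes "\<And>z i. z \<ge> N \<Longrightarrow> a z i = a' z i" "x \<le> N" "x' \<le> N"
    and "\<forall>n. \<exists>m\<ge>n. N \<le> pos (arrows a') x' m"
    and "visits_io (arrows a) x N"
  shows "visits_io (arrows a') x' N"
  using assms(5) trace_right[OF assms(1-4)] unfolding visits_io_iff_cnt by (metis order_refl)

text \<open>With every arrow left of \<open>N\<close> turned to the right, the walk from
  \<open>N\<close> never goes below \<open>N - 1\<close>. It serves as a reference walk that is a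
  function of the arrows at sites from \<open>N\<close> on.\<close>

definition reflect_at :: "int \<Rightarrow> (int \<Rightarrow> nat \<Rightarrow> bool) \<Rightarrow> int \<Rightarrow> nat \<Rightarrow> bool" where
  "reflect_at N a z i \<longleftrightarrow> z < N \<or> a z i"

lemma reflect_at_ge: "N - 1 \<le> pos (arrows (reflect_at N a)) N n"
  by (induction n) (auto simp: pos_Suc reflect_at_def)

lemma reflect_at_returns: "\<exists>m\<ge>n. N \<le> pos (arrows (reflect_at N a)) N m"
proof (cases "N \<le> pos (arrows (reflect_at N a)) N n")
  case False
  then have "pos (arrows (reflect_at N a)) N (Suc n) = N"
    using reflect_at_ge[of N a n] by (auto simp: pos_Suc reflect_at_def)
  then show ?thesis by (intro exI[of _ "Suc n"]) auto
qed blast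

text \<open>The traces are compared in both directions: the reflected walk returns by construction,
  the original one because it is unbounded above.\<close>

lemma visits_io_reflect_at:
  assumes "unbounded_above (arrows a) x" "x \<le> N"
  shows "visits_io (arrows a) x N \<longleftrightarrow> visits_io (arrows (reflect_at N a)) N N"
proof
  show "visits_io (arrows (reflect_at N a)) N N" if "visits_io (arrows a) x N"
    by (rule visits_io_trace[OF _ assms(2) _ _ that]) (auto simp: reflect_at_def reflect_at_returns)
  show "visits_io (arrows a) x N" if "visits_io (arrows (reflect_at N a)) N N"
    by (rule visits_io_trace[OF _ _ assms(2) _ that])
      (use assms(1) in \<open>auto simp: reflect_at_def unbounded_above_def\<close>)
qed

text \<open>The right-hand side involves neither \<open>x\<close> nor any arrow to the left of
  \<open>y\<close>, and its last conjunct sees only sites from \<open>N\<close> on. The zero-one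
  law, independence of the start and locality all come from this.\<close>

lemma visits_io_iff_reflect_at:
  assumes unb: "unbounded_above (arrows a) x" and N: "x \<le> N" "y \<le> N"
  shows "visits_io (arrows a) x y \<longleftrightarrow>
    (\<forall>z\<in>{y<..N}. inf_left a z) \<and> visits_io (arrows (reflect_at N a)) N N"
  using visits_io_up[OF _ unb N(2)] inf_left_if_visits_io[OF _ unb]
    visits_io_downto[OF _ N(2), of a x] visits_io_reflect_at[OF unb N(1)] by auto

subsection \<open>Independence of a coordinate and a zero-one law\<close>

text \<open>Replacing coordinate \<open>k\<close> by an independent copy preserves the product
  measure, and since \<open>A\<close> is blind to coordinate \<open>k\<close>, the event pulls back
  to the rectangle of \<open>B\<close> and \<open>A\<close>.\<close>

lemma emeasure_PiM_indep_coordinate: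
  fixes M :: "'i \<Rightarrow> 'a measure"
  assumes M: "\<And>i. prob_space (M i)"
    and A: "A \<in> sets (PiM UNIV M)" and B: "B \<in> sets (M k)"
    and inv: "\<And>U v. U \<in> space (PiM UNIV M) \<Longrightarrow> v \<in> space (M k) \<Longrightarrow> U(k := v) \<in> A \<longleftrightarrow> U \<in> A"
  shows "emeasure (PiM UNIV M) {U \<in> A. U k \<in> B} = emeasure (PiM UNIV M) A * emeasure (M k) B"
proof -
  let ?P = "PiM UNIV M" and ?f = "\<lambda>(x, X). X(k := x)"
  interpret P: prob_space ?P by (rule prob_space_PiM) (rule M)
  have f: "?f \<in> M k \<Otimes>\<^sub>M ?P \<rightarrow>\<^sub>M ?P"
    using measurable_fun_upd[of UNIV UNIV k snd "M k \<Otimes>\<^sub>M ?P" M fst]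
    by (simp add: case_prod_unfold)
  have AB: "{U \<in> A. U k \<in> B} \<in> sets ?P"
  proof -
    have "(\<lambda>U. U k) -` B \<inter> space ?P \<in> sets ?P"
      using B by (rule measurable_sets[OF measurable_component_singleton, rotated]) simp
    then have "A \<inter> ((\<lambda>U. U k) -` B \<inter> space ?P) \<in> sets ?P" using A by (rule sets.Int[rotated])
    moreover have "A \<inter> ((\<lambda>U. U k) -` B \<inter> space ?P) = {U \<in> A. U k \<in> B}"
      using sets.sets_into_space[OF A] by auto
    ultimately show ?thesis by simp
  qed
  have "emeasure ?P {U \<in> A. U k \<in> B} = emeasure (distr (M k \<Otimes>\<^sub>M ?P) ?P ?f) {U \<in> A. U k \<in> B}"
    using distr_pair_PiM_eq_PiM[of UNIV M k] M by simp
  also have "\<dots> = emeasure (M k \<Otimes>\<^sub>M ?P) (?f -` {U \<in> A. U k \<in> B} \<inter> space (M k \<Otimes>\<^sub>M ?P))"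
    using f AB by (rule emeasure_distr)
  also have "?f -` {U \<in> A. U k \<in> B} \<inter> space (M k \<Otimes>\<^sub>M ?P) = B \<times> A"
    using inv sets.sets_into_space[OF A] sets.sets_into_space[OF B]
    by (auto simp: space_pair_measure)
  also have "emeasure (M k \<Otimes>\<^sub>M ?P) (B \<times> A) = emeasure (M k) B * emeasure ?P A"
    using B A by (rule P.emeasure_pair_measure_Times)
  finally show ?thesis by (simp add: mult.commute)
qed

text \<open>Adding one coordinate at a time shows that \<open>A\<close> is independent of every
  finite-dimensional cylinder. Conditioning on \<open>A\<close>, if it is not null, therefore leaves
  the product measure unchanged, and evaluating both measures at \<open>A\<close> gives 1.\<close>

lemma PiM_zero_one:
  fixes M :: "'i \<Rightarrow> 'a measure"
  assumes M: "\<And>i. prob_space (M i)"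
    and A: "A \<in> sets (PiM UNIV M)"
    and inv: "\<And>U k v. U \<in> space (PiM UNIV M) \<Longrightarrow> v \<in> space (M k) \<Longrightarrow> U(k := v) \<in> A \<longleftrightarrow> U \<in> A"
  shows "emeasure (PiM UNIV M) A = 0 \<or> emeasure (PiM UNIV M) A = 1"
proof (rule disjCI)
  let ?P = "PiM UNIV M"
  assume pos: "emeasure ?P A \<noteq> 1"
  show "emeasure ?P A = 0"
  proof (rule ccontr)
    assume nz: "emeasure ?P A \<noteq> 0"
    interpret M: prob_space "M i" for i by (rule M)
    interpret product_prob_space M UNIV by unfold_locales
    have fin: "emeasure ?P A \<noteq> \<infinity>" by simp
    have cyl: "emeasure ?P {U \<in> A. \<forall>j\<in>J. U j \<in> F j} = emeasure ?P A * (\<Prod>j\<in>J. emeasure (M j) (F j))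
        \<and> {U \<in> A. \<forall>j\<in>J. U j \<in> F j} \<in> sets ?P"
      if "finite J" "\<And>j. j \<in> J \<Longrightarrow> F j \<in> sets (M j)" for J F
      using that
    proof (induction J rule: finite_induct)
      case empty
      then show ?case using A by simp
    next
      case (insert k J)
      let ?C = "{U \<in> A. \<forall>j\<in>J. U j \<in> F j}"
      have C: "?C \<in> sets ?P" "emeasure ?P ?C = emeasure ?P A * (\<Prod>j\<in>J. emeasure (M j) (F j))"
        using insert by auto
      have eq: "{U \<in> A. \<forall>j\<in>insert k J. U j \<in> F j} = {U \<in> ?C. U k \<in> F k}" by auto
      have "{U \<in> ?C. U k \<in> F k} = ?C \<inter> ((\<lambda>U. U k) -` F k \<inter> space ?P)"
        using sets.sets_into_space[OF A] by auto
      moreover have "(\<lambda>U. U k) -` F k \<inter> space ?P \<in> sets ?P"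
        using insert.prems by (intro measurable_sets[OF measurable_component_singleton]) auto
      ultimately have S: "{U \<in> ?C. U k \<in> F k} \<in> sets ?P" using C(1) by (simp only: sets.Int)
      have "emeasure ?P {U \<in> ?C. U k \<in> F k} = emeasure ?P ?C * emeasure (M k) (F k)"
        using insert.prems C(1) inv insert.hyps(2)
        by (intro emeasure_PiM_indep_coordinate M) (auto simp: fun_upd_def)
      then show ?case
        using S C(2) insert.hyps unfolding eq by (simp add: mult_ac)
    qed
    have "uniform_measure ?P A = ?P"
    proof (rule PiM_eq)
      fix J F assume J: "finite J" "J \<subseteq> UNIV" "\<And>j. j \<in> J \<Longrightarrow> F j \<in> sets (M j)"
      have "A \<inter> emb UNIV J (Pi\<^sub>E J F) = {U \<in> A. \<forall>j\<in>J. U j \<in> F j}"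
        using sets.sets_into_space[OF A] by (auto simp: prod_emb_def space_PiM)
      moreover have "emb UNIV J (Pi\<^sub>E J F) \<in> sets ?P" using J by (intro sets_PiM_I) auto
      ultimately show "emeasure (uniform_measure ?P A) (emb UNIV J (Pi\<^sub>E J F)) = (\<Prod>j\<in>J. emeasure (M j) (F j))"
        using cyl[of J F] J A nz fin
        by (simp add: ennreal_mult_divide_eq mult.commute[of "emeasure ?P A"])
    qed simp
    then have "emeasure ?P A = emeasure (uniform_measure ?P A) A" by simp
    also have "\<dots> = 1" using A nz by (simp add: ennreal_divide_self less_top[symmetric])
    finally show False using pos by simp
  qed
qed

corollary PiM_zero_one_AE:
  fixes M :: "'i \<Rightarrow> 'a measure"
  assumes M: "\<And>i. prob_space (M i)"
    and Q: "Measurable.pred (PiM UNIV M) Q"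
    and inv: "\<And>U k v. U \<in> space (PiM UNIV M) \<Longrightarrow> v \<in> space (M k) \<Longrightarrow> Q (U(k := v)) \<longleftrightarrow> Q U"
  shows "(AE U in PiM UNIV M. Q U) \<or> (AE U in PiM UNIV M. \<not> Q U)"
proof -
  let ?P = "PiM UNIV M"
  interpret P: prob_space ?P by (rule prob_space_PiM) (rule M)
  let ?A = "{U \<in> space ?P. Q U}"
  have A: "?A \<in> sets ?P" using Q by measurable
  have "emeasure ?P ?A = 0 \<or> emeasure ?P ?A = 1"
    by (rule PiM_zero_one[OF M A]) (auto simp: inv space_PiM PiE_iff)
  then show ?thesis
  proof
    assume "emeasure ?P ?A = 0"
    then have "AE U in ?P. \<not> Q U" using A by (subst AE_iff_measurable[OF A]) auto
    then show ?thesis by blast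
  next
    assume "emeasure ?P ?A = 1"
    then have "P.prob ?A = 1" by (simp add: measure_def)
    then have "AE U in ?P. Q U" using P.AE_prob_1[of ?A] by auto
    then show ?thesis by blast
  qed
qed

subsection \<open>Measurability of walks\<close>

lemma
  fixes b :: "'a \<Rightarrow> nat \<Rightarrow> int \<Rightarrow> nat \<Rightarrow> bool"
  assumes [measurable]: "\<And>n z i. Measurable.pred M (\<lambda>w. b w n z i)"
  shows measurable_pos: "(\<lambda>w. pos (b w) x n) \<in> measurable M (count_space UNIV)"
    and measurable_cnt: "(\<lambda>w. cnt (b w) x n z) \<in> measurable M (count_space UNIV)"
proof -
  have "(\<lambda>w. pos (b w) x n) \<in> measurable M (count_space UNIV) \<and>
    (\<forall>z. (\<lambda>w. cnt (b w) x n z) \<in> measurable M (count_space UNIV))"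
  proof (induction n)
    case (Suc n)
    then have [measurable]: "(\<lambda>w. pos (b w) x n) \<in> measurable M (count_space UNIV)"
      "\<And>z. (\<lambda>w. cnt (b w) x n z) \<in> measurable M (count_space UNIV)" by auto
    \<comment> \<open>The visit index, and in the next step also the site, is random; splitting over
      its countably many values gives measurability.\<close>
    have [measurable]: "Measurable.pred M (\<lambda>w. b w n z (cnt (b w) x n z))" for z
      by (rule measurable_compose_countable[where g = "\<lambda>w. cnt (b w) x n z"]) measurable
    have [measurable]: "Measurable.pred M (\<lambda>w. b w n (pos (b w) x n) (cnt (b w) x n (pos (b w) x n)))"
      by (rule measurable_compose_countable[where g = "\<lambda>w. pos (b w) x n"]) measurable
    show ?case by (auto simp: pos_Suc cnt_Suc fun_upd_def cong: if_cong)
  qed auto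
  then show "(\<lambda>w. pos (b w) x n) \<in> measurable M (count_space UNIV)"
    "(\<lambda>w. cnt (b w) x n z) \<in> measurable M (count_space UNIV)" by auto
qed

lemma pred_visits_io [measurable (raw)]:
  fixes b :: "'a \<Rightarrow> nat \<Rightarrow> int \<Rightarrow> nat \<Rightarrow> bool"
  assumes [measurable]: "\<And>n z i. Measurable.pred M (\<lambda>w. b w n z i)"
  shows "Measurable.pred M (\<lambda>w. visits_io (b w) x y)"
proof -
  note measurable_pos[of b M, measurable]
  show ?thesis unfolding visits_io_def by measurable
qed

subsection \<open>The walk driven by independent arrows\<close>

abbreviation unif :: "real measure" where
  "unif \<equiv> uniform_measure lborel {0..1}"

lemma prob_space_unif: "prob_space unif"
  by (rule prob_space_uniform_measure) auto

lemma measurable_unif: "measurable M unif = borel_measurable M"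
  by (rule measurable_cong_sets) simp_all

lemma space_driving_space [simp]: "space driving_space = UNIV"
  by (auto simp: driving_space_def space_PiM)

lemma measurable_driving_coord [measurable]: "(\<lambda>u. u n) \<in> borel_measurable driving_space"
  unfolding driving_space_def measurable_unif[symmetric] by (rule measurable_component_singleton) simp

lemma prob_space_driving_space: "prob_space driving_space"
  unfolding driving_space_def by (intro prob_space_PiM prob_space_unif)

definition arrow_space :: "(int \<times> nat \<Rightarrow> real) measure" where
  "arrow_space = PiM UNIV (\<lambda>_. unif)"

lemma space_arrow_space [simp]: "space arrow_space = UNIV"
  by (auto simp: arrow_space_def space_PiM)

lemma measurable_arrow_coord [measurable]: "(\<lambda>U. U k) \<in> borel_measurable arrow_space"
  unfolding arrow_space_def measurable_unif[symmetric] by (rule measurable_component_singleton) simp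

lemma prob_space_arrow_space: "prob_space arrow_space"
  unfolding arrow_space_def by (intro prob_space_PiM prob_space_unif)

definition arr :: "env \<Rightarrow> (int \<times> nat \<Rightarrow> real) \<Rightarrow> int \<Rightarrow> nat \<Rightarrow> bool" where
  "arr \<omega> U z i \<longleftrightarrow> U (z, i) < \<omega> z i"

abbreviation arrow_rule :: "env \<Rightarrow> (int \<times> nat \<Rightarrow> real) \<Rightarrow> nat \<Rightarrow> int \<Rightarrow> nat \<Rightarrow> bool" where
  "arrow_rule \<omega> U \<equiv> arrows (arr \<omega> U)"

abbreviation time_rule :: "env \<Rightarrow> (nat \<Rightarrow> real) \<Rightarrow> nat \<Rightarrow> int \<Rightarrow> nat \<Rightarrow> bool" where
  "time_rule \<omega> u \<equiv> \<lambda>n z i. u n < \<omega> z i"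

lemma pred_arr [measurable]: "Measurable.pred arrow_space (\<lambda>U. arr \<omega> U z i)"
  unfolding arr_def by measurable

lemma ewalk_state_eq_gst: "ewalk_state \<omega> x u n = gst (time_rule \<omega> u) x n"
  by (induction n) (simp_all add: case_prod_unfold Let_def)

lemma ewalk_eq_pos: "ewalk \<omega> x u n = pos (time_rule \<omega> u) x n"
  by (simp add: ewalk_def pos_def ewalk_state_eq_gst)

lemma prob_R_eq: "prob_R \<omega> x y = measure driving_space {u. visits_io (time_rule \<omega> u) x y}"
  by (simp add: prob_R_def visits_io_def ewalk_eq_pos)

section \<open>The uniform variables in the order in which the arrow walk uses them\<close>

definition key :: "env \<Rightarrow> int \<Rightarrow> (int \<times> nat \<Rightarrow> real) \<Rightarrow> nat \<Rightarrow> int \<times> nat" where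
  "key \<omega> x U n = (let p = pos (arrow_rule \<omega> U) x n in (p, cnt (arrow_rule \<omega> U) x n p))"

text \<open>Fed to the time-driven rule, this sequence reproduces the arrow walk. Once it is known
  to be i.i.d. uniform again, both constructions of the walk have the same law.\<close>

definition read_arrows :: "env \<Rightarrow> int \<Rightarrow> (int \<times> nat \<Rightarrow> real) \<Rightarrow> nat \<Rightarrow> real" where
  "read_arrows \<omega> x U n = U (key \<omega> x U n)"

lemma pos_read_arrows: "pos (time_rule \<omega> (read_arrows \<omega> x U)) x n = pos (arrow_rule \<omega> U) x n"
proof -
  have "gst (time_rule \<omega> (read_arrows \<omega> x U)) x n = gst (arrow_rule \<omega> U) x n"
  proof (induction n)
    case (Suc n)
    let ?g = "gst (arrow_rule \<omega> U) x n"
    have "read_arrows \<omega> x U n < \<omega> (fst ?g) (snd ?g (fst ?g)) \<longleftrightarrow> arr \<omega> U (fst ?g) (snd ?g (fst ?g))"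
      by (simp add: read_arrows_def key_def pos_def cnt_def Let_def arr_def)
    then show ?case using Suc by (simp add: case_prod_unfold Let_def)
  qed simp
  then show ?thesis by (simp add: pos_def)
qed

lemma visits_io_read_arrows:
  "visits_io (time_rule \<omega> (read_arrows \<omega> x U)) x y \<longleftrightarrow> visits_io (arrow_rule \<omega> U) x y"
  by (simp add: visits_io_def pos_read_arrows)

lemma measurable_key [measurable]: "(\<lambda>U. key \<omega> x U n) \<in> measurable arrow_space (count_space UNIV)"
proof -
  have rule: "Measurable.pred arrow_space (\<lambda>U. arrow_rule \<omega> U n z i)" for n z i by measurable
  have p [measurable]: "(\<lambda>U. pos (arrow_rule \<omega> U) x n) \<in> measurable arrow_space (count_space UNIV)"
    by (rule measurable_pos) measurable
  have [measurable]: "(\<lambda>U. cnt (arrow_rule \<omega> U) x n z) \<in> measurable arrow_space (count_space UNIV)" for z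
    by (rule measurable_cnt) measurable
  have "(\<lambda>U. (z, cnt (arrow_rule \<omega> U) x n z)) \<in> measurable arrow_space (count_space UNIV)" for z
    by measurable
  then show ?thesis
    unfolding key_def Let_def by (rule measurable_compose_countable[OF _ p])
qed

lemma measurable_read_arrows_coord [measurable]:
  "(\<lambda>U. read_arrows \<omega> x U n) \<in> borel_measurable arrow_space"
  unfolding read_arrows_def by (rule measurable_compose_countable[OF _ measurable_key]) measurable

lemma measurable_read_arrows [measurable]:
  "read_arrows \<omega> x \<in> measurable arrow_space driving_space"
  unfolding driving_space_def
proof (rule measurable_PiM_single')
  show "(\<lambda>U. read_arrows \<omega> x U n) \<in> measurable arrow_space unif" for n
    unfolding measurable_unif by (rule measurable_read_arrows_coord)
qed simp

text \<open>The arrow read at time \<open>n\<close> has not been read before, so changing it does not affect the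
  past.\<close>

lemma gst_upd_key:
  assumes "key \<omega> x U n = k" "m \<le> n"
  shows "gst (arrow_rule \<omega> (U(k := v))) x m = gst (arrow_rule \<omega> U) x m"
  using assms(2)
proof (induction m)
  case (Suc m)
  let ?b = "arrow_rule \<omega> U"
  have "(pos ?b x m, cnt ?b x m (pos ?b x m)) \<noteq> k"
    using cnt_less[of m n ?b x] Suc.prems assms(1) by (auto simp: key_def Let_def)
  then have "arr \<omega> (U(k := v)) (pos ?b x m) (cnt ?b x m (pos ?b x m)) =
      arr \<omega> U (pos ?b x m) (cnt ?b x m (pos ?b x m))"
    by (simp add: arr_def)
  then show ?case using Suc by (simp add: case_prod_unfold Let_def pos_def cnt_def del: fun_upd_apply)
qed simp

lemma key_upd_key:
  assumes "key \<omega> x U n = k" "m \<le> n"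
  shows "key \<omega> x (U(k := v)) m = key \<omega> x U m"
  using gst_upd_key[OF assms] by (simp add: key_def pos_def cnt_def)

lemma key_inj: "m < n \<Longrightarrow> key \<omega> x U m \<noteq> key \<omega> x U n"
  using cnt_less[of m n "arrow_rule \<omega> U" x] by (auto simp: key_def Let_def)

lemma read_arrows_upd_key:
  assumes "key \<omega> x U n = k" "m < n"
  shows "read_arrows \<omega> x (U(k := v)) m = read_arrows \<omega> x U m"
  using key_upd_key[OF assms(1), of m v] key_inj[OF assms(2), of \<omega> x U] assms
  by (simp add: read_arrows_def)

text \<open>Induction on \<open>n\<close>. The event that arrow \<open>k\<close> is read at time
  \<open>n\<close> and that the first \<open>n\<close> values satisfy their constraints does not
  depend on \<open>U k\<close>, so the value read at time \<open>n\<close> contributes an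
  independent factor. Summing over \<open>k\<close> completes the step.\<close>

lemma emeasure_read_arrows:
  assumes F: "\<And>j. F j \<in> sets borel"
  shows "emeasure arrow_space {U. \<forall>j<n. read_arrows \<omega> x U j \<in> F j} = (\<Prod>j<n. emeasure unif (F j))"
proof (induction n)
  case 0
  show ?case using prob_space.emeasure_space_1[OF prob_space_arrow_space] by simp
next
  case (Suc n)
  let ?M = arrow_space
  note F [measurable]
  define A where "A k = {U. (\<forall>j<n. read_arrows \<omega> x U j \<in> F j) \<and> key \<omega> x U n = k}" for k
  have A: "A k \<in> sets ?M" for k
  proof -
    have "Measurable.pred ?M (\<lambda>U. (\<forall>j<n. read_arrows \<omega> x U j \<in> F j) \<and> key \<omega> x U n = k)"
      by measurable
    then show ?thesis unfolding A_def pred_def by simp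
  qed
  have upd: "U(k := v) \<in> A k" if "U \<in> A k" for U k v
    using that read_arrows_upd_key[of \<omega> x U n k] key_upd_key[of \<omega> x U n k n] by (auto simp: A_def)
  \<comment> \<open>Restoring the old value \<open>U k\<close> undoes the update, so the implication
    yields the equivalence.\<close>
  have inv: "U(k := v) \<in> A k \<longleftrightarrow> U \<in> A k" for U k v
    using upd[of U k v] upd[of "U(k := v)" k "U k"] by auto
  have AF: "emeasure ?M {U \<in> A k. U k \<in> F n} = emeasure ?M (A k) * emeasure unif (F n)" for k
    unfolding arrow_space_def
    by (rule emeasure_PiM_indep_coordinate[OF prob_space_unif])
      (use A F inv in \<open>auto simp: arrow_space_def\<close>)
  have AFs: "{U \<in> A k. U k \<in> F n} \<in> sets ?M" for k
  proof -
    have "{U \<in> space ?M. U k \<in> F n} \<in> sets ?M" by measurable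
    then have "A k \<inter> {U \<in> space ?M. U k \<in> F n} \<in> sets ?M" using A by (rule sets.Int[rotated])
    then show ?thesis by (simp add: Int_def)
  qed
  have "{U. \<forall>j<Suc n. read_arrows \<omega> x U j \<in> F j} = (\<Union>k. {U \<in> A k. U k \<in> F n})"
    by (auto simp: A_def less_Suc_eq read_arrows_def)
  then have "emeasure ?M {U. \<forall>j<Suc n. read_arrows \<omega> x U j \<in> F j} =
      emeasure ?M (\<Union>k. {U \<in> A k. U k \<in> F n})"
    by (simp only:)
  also have "\<dots> = (\<integral>\<^sup>+k. emeasure ?M {U \<in> A k. U k \<in> F n} \<partial>count_space UNIV)"
    using AFs by (intro emeasure_UN_countable) (auto simp: disjoint_family_on_def A_def)
  also have "\<dots> = (\<integral>\<^sup>+k. emeasure ?M (A k) * emeasure unif (F n) \<partial>count_space UNIV)"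
    by (simp only: AF)
  also have "\<dots> = (\<integral>\<^sup>+k. emeasure ?M (A k) \<partial>count_space UNIV) * emeasure unif (F n)"
    by (rule nn_integral_multc) simp
  also have "(\<integral>\<^sup>+k. emeasure ?M (A k) \<partial>count_space UNIV) = emeasure ?M (\<Union>k. A k)"
    using A by (subst emeasure_UN_countable) (auto simp: disjoint_family_on_def A_def)
  also have "(\<Union>k. A k) = {U. \<forall>j<n. read_arrows \<omega> x U j \<in> F j}"
    by (auto simp: A_def)
  finally show ?case by (simp only: Suc.IH lessThan_Suc) (simp add: mult.commute)
qed

lemma distr_read_arrows: "distr arrow_space driving_space (read_arrows \<omega> x) = driving_space"
proof -
  interpret unif: prob_space unif by (rule prob_space_unif)
  interpret product_prob_space "\<lambda>_::nat. unif" UNIV by unfold_locales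
  show ?thesis unfolding driving_space_def
  proof (rule PiM_eq)
    fix J :: "nat set" and F assume J: "finite J" "J \<subseteq> UNIV" "\<And>j. j \<in> J \<Longrightarrow> F j \<in> sets unif"
    \<comment> \<open>Coordinates outside \<open>J\<close> get the trivial constraint, which turns
      the cylinder over \<open>J\<close> into one over an initial segment.\<close>
    define F' where "F' j = (if j \<in> J then F j else UNIV)" for j
    obtain n where n: "J \<subseteq> {..<n}" using finite_nat_iff_bounded J(1) by blast
    have F': "F' j \<in> sets borel" for j using J(3) by (auto simp: F'_def)
    have E: "emb UNIV J (Pi\<^sub>E J F) \<in> sets (PiM UNIV (\<lambda>_. unif))"
      using J by (intro sets_PiM_I) auto
    have "emeasure (distr arrow_space (PiM UNIV (\<lambda>_. unif)) (read_arrows \<omega> x)) (emb UNIV J (Pi\<^sub>E J F))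
        = emeasure arrow_space (read_arrows \<omega> x -` emb UNIV J (Pi\<^sub>E J F) \<inter> space arrow_space)"
      using measurable_read_arrows E unfolding driving_space_def by (rule emeasure_distr)
    also have "read_arrows \<omega> x -` emb UNIV J (Pi\<^sub>E J F) \<inter> space arrow_space =
        {U. \<forall>j<n. read_arrows \<omega> x U j \<in> F' j}"
      using n by (fastforce simp: prod_emb_def F'_def PiE_iff)
    also have "emeasure arrow_space \<dots> = (\<Prod>j<n. emeasure unif (F' j))"
      by (rule emeasure_read_arrows[OF F'])
    also have "\<dots> = (\<Prod>j\<in>J. emeasure unif (F j))"
      using n unif.emeasure_space_1 by (intro prod.mono_neutral_cong_right) (auto simp: F'_def)
    finally show "emeasure (distr arrow_space (PiM UNIV (\<lambda>_. unif)) (read_arrows \<omega> x))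
        (emb UNIV J (Pi\<^sub>E J F)) = (\<Prod>j\<in>J. emeasure unif (F j))" .
  qed simp
qed

lemma pred_visits_io_time [measurable]:
  "Measurable.pred driving_space (\<lambda>u. visits_io (time_rule \<omega> u) x y)"
  by measurable

lemma pred_visits_io_arrow [measurable]:
  "Measurable.pred arrow_space (\<lambda>U. visits_io (arrow_rule \<omega> U) x y)"
  by measurable

text \<open>In the arrow space, walks with different starting points and environments use the same
  variables, so their probabilities can be compared pathwise.\<close>

lemma prob_R_arrow_space:
  "prob_R \<omega> x y = measure arrow_space {U. visits_io (arrow_rule \<omega> U) x y}"
proof -
  have S: "{u. visits_io (time_rule \<omega> u) x y} \<in> sets driving_space"
    using pred_visits_io_time[of \<omega> x y] by (simp add: pred_def)
  have "prob_R \<omega> x y =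
      measure (distr arrow_space driving_space (read_arrows \<omega> x)) {u. visits_io (time_rule \<omega> u) x y}"
    by (simp add: distr_read_arrows prob_R_eq)
  also have "\<dots> = measure arrow_space
      (read_arrows \<omega> x -` {u. visits_io (time_rule \<omega> u) x y} \<inter> space arrow_space)"
    by (rule measure_distr[OF measurable_read_arrows S])
  finally show ?thesis by (simp add: visits_io_read_arrows vimage_def)
qed

lemma prob_R_cong_AE:
  assumes "AE U in arrow_space. visits_io (arrow_rule \<omega> U) x y \<longleftrightarrow> visits_io (arrow_rule \<omega>' U) x' y'"
  shows "prob_R \<omega> x y = prob_R \<omega>' x' y'"
  unfolding prob_R_arrow_space
proof (rule finite_measure.finite_measure_eq_AE)
  show "finite_measure arrow_space"
    using prob_space_arrow_space by (rule prob_space.finite_measure)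
  show "{U. visits_io (arrow_rule \<omega> U) x y} \<in> sets arrow_space"
    "{U. visits_io (arrow_rule \<omega>' U) x' y'} \<in> sets arrow_space"
    using pred_visits_io_arrow[of \<omega> x y] pred_visits_io_arrow[of \<omega>' x' y'] by (auto simp: pred_def)
qed (use assms in simp)

lemma prob_R_eq_1: "(AE U in arrow_space. visits_io (arrow_rule \<omega> U) x y) \<longleftrightarrow> prob_R \<omega> x y = 1"
  using prob_space.prob_Collect_eq_1[OF prob_space_arrow_space, of "\<lambda>U. visits_io (arrow_rule \<omega> U) x y"]
    pred_visits_io_arrow[of \<omega> x y] by (auto simp: pred_def prob_R_arrow_space)

lemma prob_R_eq_0: "(AE U in arrow_space. \<not> visits_io (arrow_rule \<omega> U) x y) \<longleftrightarrow> prob_R \<omega> x y = 0"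
  using prob_space.prob_Collect_eq_0[OF prob_space_arrow_space, of "\<lambda>U. visits_io (arrow_rule \<omega> U) x y"]
    pred_visits_io_arrow[of \<omega> x y] by (auto simp: pred_def prob_R_arrow_space)

subsection \<open>Simple random walk is unbounded above\<close>

definition srw :: "(nat \<Rightarrow> real) \<Rightarrow> nat \<Rightarrow> int" where
  "srw u n = (\<Sum>j<n. if u j < 1/2 then 1 else -1)"

lemma srw_0 [simp]: "srw u 0 = 0"
  and srw_Suc: "srw u (Suc n) = srw u n + (if u n < 1/2 then 1 else -1)"
  by (simp_all add: srw_def)

lemma srw_le: "srw u n \<le> int n"
  by (induction n) (auto simp: srw_Suc)

text \<open>As every cookie is at least 1/2, each up step of the simple walk forces a right step of
  the excited walk driven by the same variables.\<close>

lemma srw_le_pos: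
  assumes "\<And>z i. 1/2 \<le> \<omega> z i"
  shows "x + srw u n \<le> pos (time_rule \<omega> u) x n"
proof (induction n)
  case (Suc n)
  have "time_rule \<omega> u n z i" if "u n < 1/2" for z i
    using that assms by (rule less_le_trans)
  then show ?case using Suc by (auto simp: srw_Suc pos_Suc)
qed simp

lemma srw_upd: "\<bar>srw (u(k := v)) n - srw u n\<bar> \<le> (if k < n then 2 else 0)"
  by (induction n) (auto simp: srw_Suc)

lemma srw_upd_le: "srw u n \<le> srw (u(k := v)) n + 2"
  using srw_upd[of u k v n] by (auto split: if_splits)

lemma srw_run: "(\<And>j. j < L \<Longrightarrow> u (m + j) < 1/2) \<Longrightarrow> srw u (m + L) = srw u m + int L"
  by (induction L) (auto simp: srw_Suc)

lemma measurable_srw [measurable]: "(\<lambda>u. srw u n) \<in> measurable driving_space (count_space UNIV)"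
  by (induction n) (auto simp: srw_Suc)

lemma emeasure_unif_half: "emeasure unif {..<1/2} = ennreal (1/2)"
proof -
  have "{0..1} \<inter> {..<1/2} = {0..<1/2::real}" by auto
  moreover have "emeasure lborel {0..<1/2::real} = ennreal (1/2)"
    by (subst emeasure_lborel_Ico) simp_all
  ultimately have "emeasure unif {..<1/2} = ennreal (1/2) / emeasure lborel {0..1::real}"
    by (subst emeasure_uniform_measure) simp_all
  then show ?thesis by (simp add: divide_ennreal_def)
qed

text \<open>A run starts at \<open>n\<close> with probability \<open>(1/2)^L\<close>, so runs start
  infinitely often with at least that probability. Changing one variable does not affect this event,
  and the zero-one law makes it almost sure.\<close>

lemma AE_runs: "AE u in driving_space. \<forall>n. \<exists>m\<ge>n. \<forall>j<L. u (m + j) < 1/2"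
proof -
  interpret D: prob_space driving_space by (rule prob_space_driving_space)
  interpret unif: prob_space unif by (rule prob_space_unif)
  interpret product_prob_space "\<lambda>_::nat. unif" UNIV by unfold_locales
  define B where "B n = {u. \<exists>m\<ge>n. \<forall>j<L. u (m + j) < (1/2::real)}" for n :: nat
  let ?Q = "\<lambda>u. \<forall>n. \<exists>m\<ge>n. \<forall>j<L. u (m + j) < (1/2::real)"
  have B: "B n \<in> sets driving_space" for n
  proof -
    have "Measurable.pred driving_space (\<lambda>u. \<exists>m\<ge>n. \<forall>j<L. u (m + j) < (1/2::real))" by measurable
    then show ?thesis by (simp add: B_def pred_def)
  qed
  have run: "emeasure driving_space {u. \<forall>j<L. u (n + j) < 1/2} = ennreal ((1/2)^L)" for n
  proof -
    have J: "{n..<n+L} = (+) n ` {..<L}" by (simp add: lessThan_atLeast0 add.commute)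
    have "{u. \<forall>j<L. u (n + j) < 1/2} =
        {u \<in> space (PiM UNIV (\<lambda>_. unif)). \<forall>i\<in>{n..<n+L}. u i \<in> {..<1/2::real}}"
      unfolding J by (auto simp: space_PiM)
    then have "emeasure driving_space {u. \<forall>j<L. u (n + j) < 1/2} =
        (\<Prod>i\<in>{n..<n+L}. emeasure unif {..<1/2})"
      unfolding driving_space_def by (simp only:) (rule emeasure_PiM_Collect, auto)
    also have "\<dots> = ennreal (1/2) ^ L" by (simp only: emeasure_unif_half) simp
    finally show ?thesis by (simp only: ennreal_power)
  qed
  have Bn: "(1/2)^L \<le> D.prob (B n)" for n
  proof -
    have "emeasure driving_space {u. \<forall>j<L. u (n + j) < 1/2} \<le> emeasure driving_space (B n)"
      using B by (intro emeasure_mono) (auto simp: B_def)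
    then have "ennreal ((1/2)^L) \<le> ennreal (D.prob (B n))"
      unfolding run by (simp only: D.emeasure_eq_measure)
    then show ?thesis by (simp only: ennreal_le_iff measure_nonneg)
  qed
  have lim: "(\<lambda>n. D.prob (B n)) \<longlonglongrightarrow> D.prob (\<Inter>n. B n)"
    using B by (intro D.finite_Lim_measure_decseq) (auto simp: decseq_def B_def, meson le_trans)
  have "(1/2)^L \<le> D.prob (\<Inter>n. B n)" using Bn by (intro LIMSEQ_le_const[OF lim]) auto
  then have pos: "0 < D.prob (\<Inter>n. B n)" by (rule less_le_trans[rotated]) simp
  have Qset: "(\<Inter>n. B n) = {u. ?Q u}" by (auto simp: B_def)
  have "(AE u in driving_space. ?Q u) \<or> (AE u in driving_space. \<not> ?Q u)"
    unfolding driving_space_def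
  proof (rule PiM_zero_one_AE[OF prob_space_unif])
    show "Measurable.pred (PiM UNIV (\<lambda>_. unif)) ?Q"
      unfolding driving_space_def[symmetric] by measurable
    fix u :: "nat \<Rightarrow> real" and k v
    have eq: "?Q u'" if Qu: "?Q u" and eq: "\<And>i. i \<noteq> k \<Longrightarrow> u i = u' i" for u u'
    proof
      fix n
      \<comment> \<open>A run that starts after time \<open>k\<close> does not see the changed
        variable.\<close>
      obtain m where "m \<ge> max n (Suc k)" "\<forall>j<L. u (m + j) < 1/2" using Qu by blast
      then show "\<exists>m\<ge>n. \<forall>j<L. u' (m + j) < 1/2" using eq by (intro exI[of _ m]) auto
    qed
    show "?Q (u(k := v)) \<longleftrightarrow> ?Q u"
      by (rule iffI) (erule eq, simp)+
  qed
  moreover have False if "AE u in driving_space. \<not> ?Q u"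
  proof -
    have "AE u in driving_space. u \<notin> (\<Inter>n. B n)" using that unfolding Qset by simp
    then have "D.prob (\<Inter>n. B n) = 0" using B by (subst D.prob_eq_0) auto
    then show False using pos by simp
  qed
  ultimately show ?thesis by blast
qed

section \<open>Symmetry of simple random walk\<close>

lemma emeasure_unif_reflect:
  assumes B: "B \<in> sets borel"
  shows "emeasure unif ((\<lambda>v. 1 - v) -` B) = emeasure unif B"
proof -
  have [measurable]: "(\<lambda>v::real. 1 - v) -` B \<in> sets borel"
    using measurable_sets[of "\<lambda>v::real. 1 - v" borel borel B] B by simp
  note B [measurable]
  have "emeasure lborel ({0..1} \<inter> B) =
      emeasure (density (distr lborel borel (\<lambda>x. 1 + (-1) * x)) (\<lambda>_. ennreal \<bar>-1\<bar>)) ({0..1} \<inter> B)"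
    using lborel_real_affine[of "-1" 1] by simp
  also have "\<dots> = emeasure (distr lborel borel (\<lambda>x. 1 + (-1) * x)) ({0..1} \<inter> B)"
    by (simp add: density_1)
  also have "\<dots> = emeasure lborel ((\<lambda>x. 1 + (-1) * x) -` ({0..1} \<inter> B))"
    by (subst emeasure_distr) auto
  also have "(\<lambda>x. 1 + (-1) * x) -` ({0..1} \<inter> B) = {0..1} \<inter> (\<lambda>v. 1 - v) -` B" by auto
  finally show ?thesis by simp
qed

text \<open>Reflecting every variable at 1/2 exchanges the up and down steps of \<open>srw\<close>,
  except where the variable equals 1/2; such ties have probability 0.\<close>

lemma distr_reflect: "distr driving_space driving_space (\<lambda>u n. 1 - u n) = driving_space"
  and measurable_reflect: "(\<lambda>u n. 1 - u n) \<in> measurable driving_space driving_space"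
proof -
  let ?r = "\<lambda>(u :: nat \<Rightarrow> real) n. 1 - u n"
  interpret unif: prob_space unif by (rule prob_space_unif)
  interpret product_prob_space "\<lambda>_::nat. unif" UNIV by unfold_locales
  show r: "?r \<in> measurable driving_space driving_space"
  proof (subst (2) driving_space_def, rule measurable_PiM_single')
    have "(\<lambda>u. 1 - u n) \<in> borel_measurable driving_space" for n by measurable
    then show "(\<lambda>u. 1 - u n) \<in> measurable driving_space unif" for n
      unfolding measurable_unif .
  qed simp
  show "distr driving_space driving_space ?r = driving_space"
  proof (subst (3) driving_space_def, rule PiM_eq)
    fix J :: "nat set" and F assume J: "finite J" "J \<subseteq> UNIV" "\<And>j. j \<in> J \<Longrightarrow> F j \<in> sets unif"
    have E: "emb UNIV J (Pi\<^sub>E J F) \<in> sets driving_space"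
      unfolding driving_space_def using J by (intro sets_PiM_I) auto
    have G: "(\<lambda>v. 1 - v) -` F j \<in> sets unif" if "j \<in> J" for j
      using measurable_sets[of "\<lambda>v::real. 1 - v" borel borel "F j"] J(3)[OF that] by simp
    have "emeasure (distr driving_space driving_space ?r) (emb UNIV J (Pi\<^sub>E J F)) =
        emeasure driving_space (?r -` emb UNIV J (Pi\<^sub>E J F) \<inter> space driving_space)"
      using r E by (rule emeasure_distr)
    also have "?r -` emb UNIV J (Pi\<^sub>E J F) \<inter> space driving_space =
        emb UNIV J (\<Pi>\<^sub>E j\<in>J. (\<lambda>v. 1 - v) -` F j)"
      by (auto simp: prod_emb_def PiE_iff)
    also have "emeasure driving_space \<dots> = (\<Prod>j\<in>J. emeasure unif ((\<lambda>v. 1 - v) -` F j))"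
      unfolding driving_space_def using J G by (intro emeasure_PiM_emb) auto
    also have "\<dots> = (\<Prod>j\<in>J. emeasure unif (F j))"
      using J(3) by (intro prod.cong refl emeasure_unif_reflect) auto
    finally show "emeasure (distr driving_space driving_space ?r) (emb UNIV J (Pi\<^sub>E J F)) =
        (\<Prod>j\<in>J. emeasure unif (F j))" .
  qed (simp add: driving_space_def)
qed

lemma AE_driving_neq: "AE u in driving_space. \<forall>n. u n \<noteq> c"
proof -
  have "AE v in unif. v \<noteq> c"
  proof (rule AE_uniform_measureI)
    show "AE v in lborel. v \<in> {0..1} \<longrightarrow> v \<noteq> c" by (rule AE_mp[OF AE_lborel_singleton[of c]]) simp
  qed simp
  then have "AE u in driving_space. u n \<noteq> c" for n
    unfolding driving_space_def by (intro AE_PiM_component prob_space_unif) auto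
  then show ?thesis by (simp add: AE_all_countable)
qed

text \<open>By the zero-one law the alternative is that the walk is almost surely bounded above. By
  symmetry it is then bounded below as well, and arbitrarily long runs of up steps rule this
  out.\<close>

lemma AE_srw_unbounded: "AE u in driving_space. \<forall>K. \<exists>m. K \<le> srw u m"
proof -
  interpret D: prob_space driving_space by (rule prob_space_driving_space)
  let ?Q = "\<lambda>u. \<forall>K. \<exists>m. K \<le> srw u m"
  have Q [measurable]: "Measurable.pred driving_space ?Q" by measurable
  have "(AE u in driving_space. ?Q u) \<or> (AE u in driving_space. \<not> ?Q u)"
    unfolding driving_space_def
  proof (rule PiM_zero_one_AE[OF prob_space_unif])
    show "Measurable.pred (PiM UNIV (\<lambda>_. unif)) ?Q"
      using Q unfolding driving_space_def .
    fix u :: "nat \<Rightarrow> real" and k v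
    have upd: "?Q (u(k := v))" if Qu: "?Q u" for u v
    proof
      fix K
      \<comment> \<open>The surplus 2 absorbs the flip of a single step from 1 to -1.\<close>
      obtain m where "K + 2 \<le> srw u m" using Qu by blast
      then show "\<exists>m. K \<le> srw (u(k := v)) m" using srw_upd_le[of u m k v] by (intro exI[of _ m]) auto
    qed
    show "?Q (u(k := v)) \<longleftrightarrow> ?Q u" using upd[of u v] upd[of "u(k := v)" "u k"] by auto
  qed
  moreover have False if not: "AE u in driving_space. \<not> ?Q u"
  proof -
    have "AE u in distr driving_space driving_space (\<lambda>u n. 1 - u n). \<not> ?Q u"
      unfolding distr_reflect by (rule not)
    then have refl: "AE u in driving_space. \<not> ?Q (\<lambda>n. 1 - u n)"
      by (rule AE_distrD[OF measurable_reflect])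
    have runs: "AE u in driving_space. \<forall>L n. \<exists>m\<ge>n. \<forall>j<L. u (m + j) < 1/2"
      using AE_runs by (simp add: AE_all_countable)
    have "AE u in driving_space. False"
      using not refl runs AE_driving_neq[of "1/2"]
    proof eventually_elim
      case (elim u)
      have "srw (\<lambda>n. 1 - u n) m = - srw u m" for m
        using elim(4) by (induction m) (auto simp: srw_Suc not_less order_less_le)
      then obtain K K' where K: "\<And>m. srw u m < K" "\<And>m. - K' < srw u m"
        using elim(1,2) by (auto simp: not_le) (metis minus_less_iff)
      \<comment> \<open>The walk stays strictly between \<open>- K'\<close> and \<open>K\<close>, so
        \<open>K + K'\<close> consecutive up steps must leave this range.\<close>
      obtain m where "\<forall>j<nat (K + K'). u (m + j) < 1/2" using elim(3) by blast
      then have "srw u (m + nat (K + K')) = srw u m + int (nat (K + K'))" by (intro srw_run) auto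
      then show False using K(1)[of "m + nat (K + K')"] K(1)[of m] K(2)[of m] by simp
    qed
    then show False by simp
  qed
  ultimately show ?thesis by blast
qed

lemma AE_unbounded_above:
  assumes \<omega>: "\<And>z i. 1/2 \<le> \<omega> z i"
  shows "AE U in arrow_space. unbounded_above (arrow_rule \<omega> U) x"
proof -
  have "AE u in distr arrow_space driving_space (read_arrows \<omega> x). \<forall>K. \<exists>m. K \<le> srw u m"
    unfolding distr_read_arrows by (rule AE_srw_unbounded)
  then have "AE U in arrow_space. \<forall>K. \<exists>m. K \<le> srw (read_arrows \<omega> x U) m"
    by (rule AE_distrD[OF measurable_read_arrows])
  then show ?thesis
  proof eventually_elim
    case (elim U)
    let ?u = "read_arrows \<omega> x U"
    show ?case unfolding unbounded_above_def
    proof (intro allI)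
      fix K n
      \<comment> \<open>A simple walk at height at least \<open>n\<close> has made at least
        \<open>n\<close> steps, so the first entry of the maximum secures a late time.\<close>
      obtain m where m: "max (int n) (K - x) \<le> srw ?u m" using elim by blast
      then have "m \<ge> n" using srw_le[of ?u m] by simp
      moreover have "K \<le> pos (arrow_rule \<omega> U) x m"
        using m srw_le_pos[of \<omega> x ?u m, OF \<omega>] by (simp add: pos_read_arrows)
      ultimately show "\<exists>m\<ge>n. K \<le> pos (arrow_rule \<omega> U) x m" by blast
    qed
  qed
qed

subsection \<open>The zero-one law for a fixed environment\<close>

context
  fixes \<omega> :: env
  assumes half: "\<And>z i. 1/2 \<le> \<omega> z i"
begin

lemma AE_visits_io_iff_reflect_at:
  assumes "x \<le> N" "y \<le> N"
  shows "AE U in arrow_space. visits_io (arrow_rule \<omega> U) x y \<longleftrightarrow>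
    (\<forall>z\<in>{y<..N}. inf_left (arr \<omega> U) z) \<and> visits_io (arrows (reflect_at N (arr \<omega> U))) N N"
  using AE_unbounded_above[of \<omega> x, OF half]
  by eventually_elim (rule visits_io_iff_reflect_at[OF _ assms])

text \<open>For \<open>N\<close> at least \<open>x\<close>, \<open>x'\<close> and \<open>y\<close>,
  both walks obey the same criterion, which does not mention the start.\<close>

lemma prob_R_start: "prob_R \<omega> x y = prob_R \<omega> x' y"
proof (rule prob_R_cong_AE)
  define N where "N = max y (max x x')"
  have "x \<le> N" "x' \<le> N" "y \<le> N" by (auto simp: N_def)
  then show "AE U in arrow_space. visits_io (arrow_rule \<omega> U) x y \<longleftrightarrow> visits_io (arrow_rule \<omega> U) x' y"
    using AE_visits_io_iff_reflect_at[of x N y] AE_visits_io_iff_reflect_at[of x' N y] by auto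
qed

lemma prob_R_up:
  assumes "prob_R \<omega> y y = 1" "y \<le> z"
  shows "prob_R \<omega> z z = 1"
proof -
  have "AE U in arrow_space. visits_io (arrow_rule \<omega> U) y y" using assms(1) prob_R_eq_1 by blast
  then have "AE U in arrow_space. visits_io (arrow_rule \<omega> U) y z"
    using AE_unbounded_above[of \<omega> y, OF half]
    by eventually_elim (rule visits_io_up[OF _ _ assms(2)])
  then show ?thesis using prob_R_eq_1[of \<omega> y z] prob_R_start[of y z z] by simp
qed

lemma inf_left_zero_one:
  "(AE U in arrow_space. inf_left (arr \<omega> U) z) \<or> (AE U in arrow_space. \<not> inf_left (arr \<omega> U) z)"
  unfolding arrow_space_def
proof (rule PiM_zero_one_AE[OF prob_space_unif])
  show "Measurable.pred (PiM UNIV (\<lambda>_. unif)) (\<lambda>U. inf_left (arr \<omega> U) z)"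
    unfolding arrow_space_def[symmetric] inf_left_def by measurable
  fix U :: "int \<times> nat \<Rightarrow> real" and k v
  have transfer: "inf_left (arr \<omega> U') z"
    if inf: "inf_left (arr \<omega> U) z" and eq: "\<And>j. j \<noteq> k \<Longrightarrow> U j = U' j" for U U'
    unfolding inf_left_def
  proof
    fix n
    obtain i where "i \<ge> max n (Suc (snd k))" "\<not> arr \<omega> U z i"
      using inf unfolding inf_left_def by blast
    then show "\<exists>i\<ge>n. \<not> arr \<omega> U' z i"
      using eq[of "(z, i)"] by (intro exI[of _ i], cases k) (auto simp: arr_def)
  qed
  show "inf_left (arr \<omega> (U(k := v))) z \<longleftrightarrow> inf_left (arr \<omega> U) z"
    by (rule iffI) (erule transfer, simp)+
qed

text \<open>If some site to the right of \<open>y\<close> almost surely has only finitely many left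
  arrows, \<open>y\<close> is not visited infinitely often. Otherwise visiting \<open>y\<close>
  infinitely often agrees almost surely with an event that no single arrow can influence.\<close>

lemma prob_R_zero_one: "prob_R \<omega> x y = 0 \<or> prob_R \<omega> x y = 1"
proof (cases "\<forall>z>y. AE U in arrow_space. inf_left (arr \<omega> U) z")
  case False
  then obtain z where z: "z > y" "AE U in arrow_space. \<not> inf_left (arr \<omega> U) z"
    using inf_left_zero_one by blast
  have "AE U in arrow_space. \<not> visits_io (arrow_rule \<omega> U) x y"
    using z(2) AE_unbounded_above[of \<omega> x, OF half]
    by eventually_elim (use inf_left_if_visits_io[OF _ _ z(1)] in blast)
  then show ?thesis using prob_R_eq_0 by blast
next
  case True
  define V where "V N U = visits_io (arrows (reflect_at N (arr \<omega> U))) N N" for N U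
  have V [measurable]: "Measurable.pred arrow_space (V N)" for N
    unfolding V_def reflect_at_def by (intro pred_visits_io) measurable
  \<comment> \<open>This limit superior is exactly invariant under changes of one arrow, as the
    zero-one law demands; recurrence of \<open>y\<close> only has to agree with it almost
    surely.\<close>
  let ?Q = "\<lambda>U. \<forall>n. \<exists>k\<ge>n. V (y + int k) U"
  have "AE U in arrow_space. visits_io (arrow_rule \<omega> U) y y \<longleftrightarrow> V (y + int k) U" for k
  proof -
    have "AE U in arrow_space. \<forall>z\<in>{y<..y + int k}. inf_left (arr \<omega> U) z"
      using True by (subst AE_ball_countable) auto
    moreover have "AE U in arrow_space. visits_io (arrow_rule \<omega> U) y y \<longleftrightarrow>
        (\<forall>z\<in>{y<..y + int k}. inf_left (arr \<omega> U) z) \<and> V (y + int k) U"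
      unfolding V_def by (rule AE_visits_io_iff_reflect_at) simp_all
    ultimately show ?thesis by eventually_elim blast
  qed
  then have "AE U in arrow_space. \<forall>k. visits_io (arrow_rule \<omega> U) y y \<longleftrightarrow> V (y + int k) U"
    by (simp add: AE_all_countable)
  then have iff: "AE U in arrow_space. visits_io (arrow_rule \<omega> U) y y \<longleftrightarrow> ?Q U"
    by eventually_elim blast
  have "(AE U in arrow_space. ?Q U) \<or> (AE U in arrow_space. \<not> ?Q U)"
    unfolding arrow_space_def
  proof (rule PiM_zero_one_AE[OF prob_space_unif])
    show "Measurable.pred (PiM UNIV (\<lambda>_. unif)) ?Q"
      unfolding arrow_space_def[symmetric] by measurable
    fix U :: "int \<times> nat \<Rightarrow> real" and k v
    have transfer: "?Q U'" if Q: "?Q U" and eq: "\<And>j. j \<noteq> k \<Longrightarrow> U j = U' j" for U U'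
    proof
      fix n
      \<comment> \<open>The bound puts the reflection site \<open>y + int m\<close> strictly to the
        right of the site of \<open>k\<close>, so reflection erases the changed arrow.\<close>
      obtain m where m: "m \<ge> max n (nat (fst k - y) + 1)" "V (y + int m) U" using Q by blast
      have "reflect_at (y + int m) (arr \<omega> U) z i = reflect_at (y + int m) (arr \<omega> U') z i" for z i
      proof (cases "z < y + int m")
        case False
        moreover have "fst k < y + int m" using m(1) by linarith
        ultimately have "(z, i) \<noteq> k" by auto
        then show ?thesis using eq[of "(z, i)"] by (simp add: reflect_at_def arr_def)
      qed (simp add: reflect_at_def)
      then have "reflect_at (y + int m) (arr \<omega> U) = reflect_at (y + int m) (arr \<omega> U')"
        by blast
      then show "\<exists>m\<ge>n. V (y + int m) U'" using m unfolding V_def by (intro exI[of _ m]) auto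
    qed
    show "?Q (U(k := v)) \<longleftrightarrow> ?Q U"
      by (rule iffI) (erule transfer, simp)+
  qed
  then have "(AE U in arrow_space. visits_io (arrow_rule \<omega> U) y y) \<or>
      (AE U in arrow_space. \<not> visits_io (arrow_rule \<omega> U) y y)"
  proof
    assume "AE U in arrow_space. ?Q U"
    with iff have "AE U in arrow_space. visits_io (arrow_rule \<omega> U) y y" by eventually_elim blast
    then show ?thesis by blast
  next
    assume "AE U in arrow_space. \<not> ?Q U"
    with iff have "AE U in arrow_space. \<not> visits_io (arrow_rule \<omega> U) y y" by eventually_elim blast
    then show ?thesis by blast
  qed
  then show ?thesis using prob_R_eq_0 prob_R_eq_1 prob_R_start[of x y y] by metis
qed

lemma env_recurrent_iff: "env_recurrent \<omega> y \<longleftrightarrow> prob_R \<omega> y y = 1"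
  unfolding env_recurrent_def using prob_R_start by metis

text \<open>The zero-one law leaves 0 as the only other value of the probability.\<close>

lemma env_transient_iff: "env_transient \<omega> y \<longleftrightarrow> prob_R \<omega> y y \<noteq> 1"
  unfolding env_transient_def using prob_R_start prob_R_zero_one by (metis zero_neq_one)

end

text \<open>With \<open>N = y\<close> the condition on left arrows is empty, and reflection at
  \<open>y\<close> erases all cookies to the left of \<open>y\<close>.\<close>

lemma prob_R_local:
  assumes half: "\<And>z i. 1/2 \<le> \<omega> z i" "\<And>z i. 1/2 \<le> \<omega>' z i"
    and eq: "\<And>z. y \<le> z \<Longrightarrow> \<omega> z = \<omega>' z"
  shows "prob_R \<omega> y y = prob_R \<omega>' y y"
proof (rule prob_R_cong_AE)
  have "reflect_at y (arr \<omega> U) z i = reflect_at y (arr \<omega>' U) z i" for U z i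
    using eq[of z] by (cases "z < y") (auto simp: reflect_at_def arr_def)
  then have "reflect_at y (arr \<omega> U) = reflect_at y (arr \<omega>' U)" for U
    by blast
  then show "AE U in arrow_space. visits_io (arrow_rule \<omega> U) y y \<longleftrightarrow> visits_io (arrow_rule \<omega>' U) y y"
    using AE_visits_io_iff_reflect_at[of \<omega> y y y, OF half(1)] AE_visits_io_iff_reflect_at[of \<omega>' y y y, OF half(2)]
    by auto
qed

text \<open>In the time-driven form the same \<open>u\<close> drives both walks, so no relabeling of
  arrows is needed.\<close>

lemma prob_R_translate: "prob_R (\<lambda>z. \<omega> (z + y)) 0 0 = prob_R \<omega> y y"
proof -
  have "pos (time_rule \<omega> u) y n = pos (time_rule (\<lambda>z. \<omega> (z + y)) u) 0 n + y \<and>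
      (\<forall>z. cnt (time_rule \<omega> u) y n (z + y) = cnt (time_rule (\<lambda>z. \<omega> (z + y)) u) 0 n z)" for u n
    by (induction n) (auto simp: pos_Suc cnt_Suc)
  then show ?thesis by (simp add: prob_R_eq visits_io_def)
qed

subsection \<open>Ergodicity\<close>

text \<open>As \<open>nat z\<close> is 0 for negative \<open>z\<close>, the cookies of site 0 are
  copied to the negative half line, which keeps the lower bound 1/2. By \<open>prob_R_local\<close>,
  any environment with this bound and the same nonnegative part has the same recurrence probability
  at 0.\<close>

definition extend :: "(nat \<Rightarrow> nat \<Rightarrow> real) \<Rightarrow> env" where
  "extend s z = s (nat z)"

definition origin_recurrent :: "(nat \<Rightarrow> nat \<Rightarrow> real) \<Rightarrow> bool" where
  "origin_recurrent s \<longleftrightarrow> prob_R (extend s) 0 0 = 1"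

lemma funpow_seq_shift: "(seq_shift ^^ n) s m = s (m + n)"
  by (induction n arbitrary: m) (simp_all add: seq_shift_def)

lemma origin_recurrent_shift_nonneg_part:
  assumes "\<And>z i. 1/2 \<le> \<omega> z i"
  shows "origin_recurrent ((seq_shift ^^ n) (nonneg_part \<omega>)) \<longleftrightarrow> prob_R \<omega> (int n) (int n) = 1"
proof -
  have "prob_R (extend ((seq_shift ^^ n) (nonneg_part \<omega>))) 0 0 = prob_R (\<lambda>z. \<omega> (z + int n)) 0 0"
    by (rule prob_R_local) (use assms in \<open>auto simp: extend_def funpow_seq_shift nonneg_part_def\<close>)
  then show ?thesis unfolding origin_recurrent_def prob_R_translate by simp
qed

section \<open>Measurability of recurrence in the environment\<close>

lemma space_Omega_half: "s \<in> space Omega_half \<longleftrightarrow> (\<forall>n i. 1/2 \<le> s n i \<and> s n i \<le> 1)"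
  by (auto simp: Omega_half_def space_PiM cookie_coord_def space_restrict_space PiE_iff)

lemma space_Omega_plus: "\<omega> \<in> space Omega_plus \<longleftrightarrow> (\<forall>z i. 1/2 \<le> \<omega> z i \<and> \<omega> z i \<le> 1)"
  by (auto simp: Omega_plus_def space_PiM cookie_coord_def space_restrict_space PiE_iff)

lemma measurable_Omega_half_coord [measurable]: "(\<lambda>s. s n i) \<in> borel_measurable Omega_half"
proof -
  have "(\<lambda>x. x) \<in> borel_measurable cookie_coord"
    unfolding cookie_coord_def by (rule measurable_restrict_space1) simp
  moreover have "(\<lambda>s. s n) \<in> measurable Omega_half (PiM UNIV (\<lambda>_. cookie_coord))"
    unfolding Omega_half_def by (rule measurable_component_singleton) simp
  then have "(\<lambda>s. s n i) \<in> measurable Omega_half cookie_coord"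
    by (rule measurable_compose) (rule measurable_component_singleton, simp)
  ultimately show ?thesis by (rule measurable_compose[rotated])
qed

lemma measurable_seq_shift [measurable]: "seq_shift \<in> measurable Omega_half Omega_half"
proof (subst (2) Omega_half_def, rule measurable_PiM_single')
  show "(\<lambda>s. seq_shift s n) \<in> measurable Omega_half (PiM UNIV (\<lambda>_. cookie_coord))" for n
    unfolding Omega_half_def seq_shift_def by (rule measurable_component_singleton) simp
qed (auto simp: space_Omega_half space_PiM cookie_coord_def space_restrict_space PiE_iff seq_shift_def)

lemma measurable_nonneg_part: "nonneg_part \<in> measurable Omega_plus Omega_half"
proof (subst Omega_half_def, rule measurable_PiM_single')
  show "(\<lambda>\<omega>. nonneg_part \<omega> n) \<in> measurable Omega_plus (PiM UNIV (\<lambda>_. cookie_coord))" for n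
    unfolding Omega_plus_def nonneg_part_def by (rule measurable_component_singleton) simp
qed (auto simp: space_Omega_plus space_PiM cookie_coord_def space_restrict_space PiE_iff nonneg_part_def)

text \<open>The event is jointly measurable in the environment and the driving sequence, so the
  probability of its section is measurable in the environment.\<close>

lemma sets_origin_recurrent: "{s \<in> space Omega_half. origin_recurrent s} \<in> sets Omega_half"
proof -
  interpret D: prob_space driving_space by (rule prob_space_driving_space)
  let ?W = "{w \<in> space (Omega_half \<Otimes>\<^sub>M driving_space).
    visits_io (time_rule (extend (fst w)) (snd w)) 0 0}"
  have "Measurable.pred (Omega_half \<Otimes>\<^sub>M driving_space)
      (\<lambda>w. visits_io (time_rule (extend (fst w)) (snd w)) 0 0)"
    unfolding extend_def by (intro pred_visits_io) measurable
  then have "?W \<in> sets (Omega_half \<Otimes>\<^sub>M driving_space)" by (simp add: pred_def)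
  then have m [measurable]:
      "(\<lambda>s. emeasure driving_space (Pair s -` ?W)) \<in> borel_measurable Omega_half"
    by (rule D.measurable_emeasure_Pair)
  have "Pair s -` ?W = {u. visits_io (time_rule (extend s) u) 0 0}" if "s \<in> space Omega_half" for s
    using that by (auto simp: space_pair_measure)
  then have "{s \<in> space Omega_half. origin_recurrent s} =
      {s \<in> space Omega_half. emeasure driving_space (Pair s -` ?W) = 1}"
    by (auto simp: origin_recurrent_def prob_R_eq D.emeasure_eq_measure)
  also have "\<dots> \<in> sets Omega_half" by measurable
  finally show ?thesis .
qed

theorem mainTheorem9:
  fixes P :: "env measure"
  assumes "prob_space P"
    and "sets P = sets Omega_plus"
    and "stationary_ergodic_nonneg P"
  shows "(\<forall>x::int. x \<ge> 0 \<longrightarrow> (AE \<omega> in P. env_recurrent \<omega> x))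
       \<or> (\<forall>x::int. x \<ge> 0 \<longrightarrow> (AE \<omega> in P. env_transient \<omega> x))"
proof -
  interpret P: prob_space P by fact
  have nn: "nonneg_part \<in> measurable P Omega_half"
    using measurable_nonneg_part by (simp add: measurable_cong_sets[OF assms(2) refl])
  have half: "1/2 \<le> \<omega> z i" if "\<omega> \<in> space P" for \<omega> z i
    using that sets_eq_imp_space_eq[OF assms(2)] space_Omega_plus by auto
  define Q where "Q = distr P Omega_half nonneg_part"
  interpret Q: prob_space Q unfolding Q_def by (rule P.prob_space_distr[OF nn])
  have setsQ [simp]: "sets Q = sets Omega_half" and spaceQ [simp]: "space Q = space Omega_half"
    by (simp_all add: Q_def)
  have stat: "distr Q Omega_half seq_shift = Q"
    and erg: "\<And>A. A \<in> sets Omega_half \<Longrightarrow> seq_shift -` A \<inter> space Omega_half = A \<Longrightarrow>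
      emeasure Q A = 0 \<or> emeasure Q A = 1"
    using assms(3) unfolding stationary_ergodic_nonneg_def Let_def Q_def[symmetric] by blast+
  have shiftQ: "seq_shift \<in> measurable Q Omega_half"
    using measurable_seq_shift by (simp add: measurable_cong_sets[OF setsQ refl])
  \<comment> \<open>This is recurrence of site \<open>n\<close> read off from the nonnegative part
    alone, and the preimage of \<open>R 0\<close> under the \<open>n\<close>-fold shift.\<close>
  define R where "R n = {s \<in> space Omega_half. origin_recurrent ((seq_shift ^^ n) s)}" for n
  have shift_space: "seq_shift s \<in> space Omega_half" if "s \<in> space Omega_half" for s
    using that by (rule measurable_space[OF measurable_seq_shift])
  have R_Suc: "R (Suc n) = seq_shift -` R n \<inter> space Omega_half" for n
    using shift_space by (auto simp: R_def funpow_swap1)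
  have R: "R n \<in> sets Omega_half" for n
  proof (induction n)
    case 0
    show ?case using sets_origin_recurrent by (simp add: R_def)
  next
    case (Suc n)
    then show ?case unfolding R_Suc by (rule measurable_sets[OF measurable_seq_shift])
  qed
  have const: "emeasure Q (R n) = emeasure Q (R 0)" for n
  proof (induction n)
    case (Suc n)
    have "emeasure Q (R n) = emeasure (distr Q Omega_half seq_shift) (R n)" by (simp add: stat)
    also have "\<dots> = emeasure Q (R (Suc n))"
      using emeasure_distr[OF shiftQ R] by (simp add: R_Suc)
    finally show ?case using Suc by simp
  qed simp
  \<comment> \<open>Sites \<open>n\<close> and \<open>Suc n\<close> are compared within the single
    environment \<open>extend s\<close>, where recurrence passes to the right.\<close>
  have mono: "R n \<subseteq> R (Suc n)" for n
  proof
    fix s assume s: "s \<in> R n"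
    then have h: "\<And>z i. 1/2 \<le> extend s z i" by (auto simp: R_def space_Omega_half extend_def)
    have "nonneg_part (extend s) = s" by (auto simp: nonneg_part_def extend_def)
    then have eq: "origin_recurrent ((seq_shift ^^ m) s) \<longleftrightarrow> prob_R (extend s) (int m) (int m) = 1" for m
      using origin_recurrent_shift_nonneg_part[of "extend s" m, OF h] by simp
    have "prob_R (extend s) (int n) (int n) = 1" using s by (simp add: R_def eq)
    then have "prob_R (extend s) (int (Suc n)) (int (Suc n)) = 1" by (rule prob_R_up[OF h]) simp
    then show "s \<in> R (Suc n)" using s by (auto simp only: R_def eq mem_Collect_eq)
  qed
  have recurrent: "env_recurrent \<omega> (int n) \<longleftrightarrow> nonneg_part \<omega> \<in> R n"
    and transient: "env_transient \<omega> (int n) \<longleftrightarrow> nonneg_part \<omega> \<notin> R n" if "\<omega> \<in> space P" for \<omega> n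
    using measurable_space[OF nn that] env_recurrent_iff[of \<omega>, OF half[OF that]]
      env_transient_iff[of \<omega>, OF half[OF that]]
      origin_recurrent_shift_nonneg_part[of \<omega>, OF half[OF that]]
    by (auto simp: R_def)
  \<comment> \<open>The shift drops the first set of an increasing sequence, which does not change
    the union; this gives the exact invariance required by \<open>erg\<close>.\<close>
  have "seq_shift -` (\<Union>n. R n) \<inter> space Omega_half = (\<Union>n. R (Suc n))"
    by (auto simp: R_Suc)
  also have "\<dots> = (\<Union>n. R n)" using mono by blast
  finally have "emeasure Q (\<Union>n. R n) = 0 \<or> emeasure Q (\<Union>n. R n) = 1"
    using R by (intro erg) auto
  then show ?thesis
  proof
    assume "emeasure Q (\<Union>n. R n) = 0"
    then have "AE s in Q. s \<notin> (\<Union>n. R n)" using R by (intro AE_not_in) (auto simp: null_sets_def)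
    then have "AE \<omega> in P. nonneg_part \<omega> \<notin> (\<Union>n. R n)" unfolding Q_def by (rule AE_distrD[OF nn])
    then have "AE \<omega> in P. env_transient \<omega> (int n)" for n
      using AE_space by eventually_elim (use transient in blast)
    then show ?thesis by (metis nonneg_int_cases)
  next
    assume 1: "emeasure Q (\<Union>n. R n) = 1"
    \<comment> \<open>By continuity from below the union has the common probability of the sets
      \<open>R n\<close>, so each of them has probability 1.\<close>
    have "emeasure Q (\<Union>n. R n) = (SUP n. emeasure Q (R n))"
      using R mono by (intro SUP_emeasure_incseq[symmetric]) (auto intro!: incseq_SucI)
    also have "\<dots> = (SUP n::nat. emeasure Q (R 0))" by (rule SUP_cong[OF refl const])
    also have "\<dots> = emeasure Q (R 0)" by simp
    finally have "emeasure Q (R n) = 1" for n using 1 const[of n] by simp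
    then have "AE s in Q. s \<in> R n" for n
      using R by (intro Q.AE_prob_1) (simp add: measure_def)
    then have "AE \<omega> in P. nonneg_part \<omega> \<in> R n" for n
      unfolding Q_def by (rule AE_distrD[OF nn])
    then have "AE \<omega> in P. env_recurrent \<omega> (int n)" for n
      using AE_space by eventually_elim (use recurrent in blast)
    then show ?thesis by (metis nonneg_int_cases)
  qed
qed

end
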